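(* Let $N\ge 1$, $n_x,n_u\ge 1$ be integers, and let $f:\mathbb{R}^{n_x}\times\mathbb{R}^{n_u}\to\mathbb{R}^{n_x}$, $\ell:\mathbb{R}^{n_x}\times\mathbb{R}^{n_u}\to\mathbb{R}$ and $V_f:\mathbb{R}^{n_x}\to\mathbb{R}$ be differentiable. Let $x\in\mathbb{R}^{n_x}$ and $u=(u_0,\ldots,u_{N-1})\in\mathbb{R}^{Nn_u}$ with $u_t\in\mathbb{R}^{n_u}$, and let $V_N(x,u)$ be the total cost function defined in the context. Define vectors $a_t\in\mathbb{R}^{n_x}$ by $a_{N-1}=V_f'$ and, backwards for $t=N-1,N-2,\ldots,0$, $$a_{t-1}=\ell^x_t+f^x_t(a_t).$$ Then, for all $t=N-1,N-2,\ldots,0$, $$\nabla_{u_t}V_N(x,u)=\ell^u_t+f^u_t(a_t).$$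
   Context: For $x\in\mathbb{R}^{n_x}$ and $u=(u_0,\ldots,u_{N-1})\in\mathbb{R}^{Nn_u}$, define $F_0(x,u)=x$ and recursively $F_{t+1}(x,u)=f(F_t(x,u),u_t)$ for $t=0,\ldots,N-1$. Write $x_t=F_t(x,u)$, the state at time $t$ starting from the initial state $x$ under the action of $u$. The total cost function $V_N:\mathbb{R}^{n_x}\times\mathbb{R}^{Nn_u}\to\mathbb{R}$ is $$V_N(x,u)=\sum_{t=0}^{N-1}\ell(F_t(x,u),u_t)+V_f(F_N(x,u)).$$ $J_x f$ and $J_u f$ denote the Jacobian matrices of $f$ with respect to its first and second arguments, respectively; gradients are column vectors (transposed Jacobians), with $\nabla_x\ell$ and $\nabla_u\ell$ the gradients of $\ell$ with respect to its first and second arguments; and $\nabla_{u_t}V_N$ is the gradient of $V_N$ with respect to the block $u_t$ of $u$. For $t=0,\ldots,N-1$ and $d\in\mathbb{R}^{n_x}$, set $f^x_t(d)=J_xf(x_t,u_t)^{\top}d$, $f^u_t(d)=J_uf(x_t,u_t)^{\top}d$, $\ell^x_t=\nabla_x\ell(x_t,u_t)$, $\ell^u_t=\nabla_u\ell(x_t,u_t)$, and set $V_f'=\nabla V_f(x_N)$. *)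

theory Defs
  imports "HOL-Analysis.Analysis"
begin

text \<open>The column vector of partial derivatives, i.e. the transpose of the \<open>1 \<times> n\<close> Jacobian of a
  scalar function (the library's \<^const>\<open>jacobian\<close> only covers vector-valued functions).\<close>

definition gradient :: "(real^'n \<Rightarrow> real) \<Rightarrow> real^'n \<Rightarrow> real^'n" where
  "gradient g z = (\<chi> i. frechet_derivative g (at z) (axis i 1))"

lemma gderiv_gradient:
  assumes "g differentiable (at z)"
  shows "GDERIV g z :> gradient g z"
proof -
  let ?D = "frechet_derivative g (at z)"
  have D: "(g has_derivative ?D) (at z)"
    using assms frechet_derivative_works by blast
  then have lin: "linear ?D"
    by (rule has_derivative_linear)
  have "?D h = h \<bullet> gradient g z" for h
  proof -
    have "?D h = ?D (\<Sum>i\<in>UNIV. h $ i *\<^sub>R axis i 1)"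
      by (simp add: basis_expansion flip: scalar_mult_eq_scaleR)
    also have "\<dots> = h \<bullet> gradient g z"
      by (simp add: linear_sum[OF lin] linear_cmul[OF lin] gradient_def inner_vec_def)
    finally show ?thesis .
  qed
  with D show ?thesis
    by (metis (no_types, lifting) ext gderiv_def)
qed

text \<open>A control sequence \<open>(u\<^sub>0, \<dots>, u\<^bsub>N-1\<^esub>)\<close> is a function \<open>u\<close> on \<^typ>\<open>nat\<close>; the total cost
  over horizon \<open>N\<close> only looks at \<open>u t\<close> for \<open>t < N\<close>.\<close>

primrec state ::
    "((real^'n) \<times> (real^'m) \<Rightarrow> real^'n) \<Rightarrow> real^'n \<Rightarrow> (nat \<Rightarrow> real^'m) \<Rightarrow> nat \<Rightarrow> real^'n" where
  "state f x u 0 = x"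
| "state f x u (Suc t) = f (state f x u t, u t)"

definition total_cost ::
    "((real^'n) \<times> (real^'m) \<Rightarrow> real^'n) \<Rightarrow> ((real^'n) \<times> (real^'m) \<Rightarrow> real) \<Rightarrow> (real^'n \<Rightarrow> real) \<Rightarrow>
      nat \<Rightarrow> real^'n \<Rightarrow> (nat \<Rightarrow> real^'m) \<Rightarrow> real" where
  "total_cost f l Vf N x u = (\<Sum>t<N. l (state f x u t, u t)) + Vf (state f x u N)"

lemma total_cost_cong:
  assumes "\<And>t. t < N \<Longrightarrow> u t = u' t"
  shows "total_cost f l Vf N x u = total_cost f l Vf N x u'"
proof -
  have "state f x u t = state f x u' t" if "t \<le> N" for t
    using that assms by (induction t) auto
  with assms show ?thesis
    by (simp add: total_cost_def)
qed

definition f_x ::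
    "((real^'n) \<times> (real^'m) \<Rightarrow> real^'n) \<Rightarrow> real^'n \<Rightarrow> (nat \<Rightarrow> real^'m) \<Rightarrow> nat \<Rightarrow> real^'n \<Rightarrow> real^'n" where
  "f_x f x u t d = transpose (jacobian (\<lambda>y. f (y, u t)) (at (state f x u t))) *v d"

definition f_u ::
    "((real^'n) \<times> (real^'m) \<Rightarrow> real^'n) \<Rightarrow> real^'n \<Rightarrow> (nat \<Rightarrow> real^'m) \<Rightarrow> nat \<Rightarrow> real^'n \<Rightarrow> real^'m" where
  "f_u f x u t d = transpose (jacobian (\<lambda>v. f (state f x u t, v)) (at (u t))) *v d"

definition l_x ::
    "((real^'n) \<times> (real^'m) \<Rightarrow> real^'n) \<Rightarrow> ((real^'n) \<times> (real^'m) \<Rightarrow> real) \<Rightarrow>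
      real^'n \<Rightarrow> (nat \<Rightarrow> real^'m) \<Rightarrow> nat \<Rightarrow> real^'n" where
  "l_x f l x u t = gradient (\<lambda>y. l (y, u t)) (state f x u t)"

definition l_u ::
    "((real^'n) \<times> (real^'m) \<Rightarrow> real^'n) \<Rightarrow> ((real^'n) \<times> (real^'m) \<Rightarrow> real) \<Rightarrow>
      real^'n \<Rightarrow> (nat \<Rightarrow> real^'m) \<Rightarrow> nat \<Rightarrow> real^'m" where
  "l_u f l x u t = gradient (\<lambda>v. l (state f x u t, v)) (u t)"

end

theory Submission
  imports Defs
begin

text \<open>
  Fix a time \<open>s\<close>. The total cost is the cost accumulated before \<open>s\<close> plus the cost-to-go from the
  state \<open>x\<^sub>s\<close>, which is again a total cost, with horizon \<open>N - s\<close>, initial state \<open>x\<^sub>s\<close> and the shifted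
  controls (\<open>total_cost_split\<close>). The idea of the proof is that the backward recursion for \<open>a\<close> is the
  chain rule applied to Bellman's equation
  \<open>W\<^sub>s(y) = l(y, u\<^sub>s) + W\<^bsub>s+1\<^esub>(f(y, u\<^sub>s))\<close> for the cost-to-go \<open>W\<^sub>s\<close> under the fixed controls \<open>u\<close>,
  with terminal value \<open>W\<^sub>N = V\<^sub>f\<close>. Hence \<open>a\<^bsub>s-1\<^esub>\<close> is the gradient of \<open>W\<^sub>s\<close> at \<open>x\<^sub>s\<close>
  (\<open>costate_is_gradient_of_cost_to_go\<close>).

  Changing only \<open>u\<^sub>t\<close> leaves everything up to the state \<open>x\<^sub>t\<close> and all controls after time \<open>t\<close> unchanged, so
  as a function of \<open>v = u\<^sub>t\<close> the total cost is a constant plus \<open>l(x\<^sub>t, v) + W\<^bsub>t+1\<^esub>(f(x\<^sub>t, v))\<close>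
  (\<open>total_cost_fun_upd\<close>). One more use of the same chain rule, this time in the control argument,
  gives the claim, because the gradient of \<open>W\<^bsub>t+1\<^esub>\<close> at \<open>x\<^bsub>t+1\<^esub> = f(x\<^sub>t, u\<^sub>t)\<close> is \<open>a\<^sub>t\<close>.
\<close>

lemma gradient_eqI:
  assumes "GDERIV g z :> d"
  shows "g differentiable (at z)" and "gradient g z = d"
proof -
  have D: "(g has_derivative (\<lambda>h. h \<bullet> d)) (at z)"
    using assms by (simp add: gderiv_def)
  then show "g differentiable (at z)"
    by (rule differentiableI)
  have "frechet_derivative g (at z) = (\<lambda>h. h \<bullet> d)"
    using frechet_derivative_at[OF D] by simp
  then show "gradient g z = d"
    by (simp add: gradient_def vec_eq_iff inner_axis')
qed

text \<open>The transposed Jacobian enters as the adjoint of the derivative of \<open>\<phi>\<close>. The rule serves twice: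
  with \<open>z\<close> a state it yields the recursion for \<open>a\<close>, with \<open>z\<close> a control the gradient formula.\<close>

lemma GDERIV_stage_plus_tail:
  fixes c :: "real^'k \<Rightarrow> real" and \<phi> :: "real^'k \<Rightarrow> real^'n"
  assumes c: "c differentiable (at z)"
    and \<phi>: "\<phi> differentiable (at z)"
    and W: "GDERIV W (\<phi> z) :> d"
  shows "GDERIV (\<lambda>y. c y + W (\<phi> y)) z :> gradient c z + transpose (jacobian \<phi> (at z)) *v d"
proof -
  let ?J = "jacobian \<phi> (at z)"
  have "(\<phi> has_derivative (\<lambda>h. ?J *v h)) (at z)"
    using \<phi> jacobian_works by blast
  moreover have "(W has_derivative (\<lambda>h. h \<bullet> d)) (at (\<phi> z))"
    using W by (simp add: gderiv_def)
  ultimately have "((\<lambda>y. W (\<phi> y)) has_derivative (\<lambda>h. (?J *v h) \<bullet> d)) (at z)"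
    by (rule has_derivative_compose)
  moreover have "(?J *v h) \<bullet> d = h \<bullet> (transpose ?J *v d)" for h
    by (metis dot_lmul_matrix inner_commute transpose_matrix_vector)
  ultimately have "GDERIV (\<lambda>y. W (\<phi> y)) z :> transpose ?J *v d"
    by (simp add: gderiv_def)
  with gderiv_gradient[OF c] show ?thesis
    by (rule GDERIV_add)
qed

lemma differentiable_partial:
  assumes "g differentiable_on UNIV"
  shows "(\<lambda>y. g (y, w)) differentiable (at y)" and "(\<lambda>w. g (y, w)) differentiable (at w)"
proof -
  have g: "g differentiable (at (y, w))"
    using assms by (simp add: differentiable_on_def)
  have "(\<lambda>y. (y, w)) differentiable (at y)" "(\<lambda>w. (y, w)) differentiable (at w)"
    by (auto intro!: differentiableI derivative_eq_intros)
  with g show "(\<lambda>y. g (y, w)) differentiable (at y)" "(\<lambda>w. g (y, w)) differentiable (at w)"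
    by (auto intro: differentiable_compose[where f = g])
qed

lemma state_add:
  "state f x u (s + k) = state f (state f x u s) (\<lambda>j. u (s + j)) k"
  by (induction k) auto

lemma total_cost_split:
  "total_cost f l Vf (s + n) x u =
    (\<Sum>t<s. l (state f x u t, u t)) + total_cost f l Vf n (state f x u s) (\<lambda>j. u (s + j))"
proof -
  have "(\<Sum>t<s + n. g t) = (\<Sum>t<s. g t) + (\<Sum>t<n. g (s + t))" for g :: "nat \<Rightarrow> real"
    by (induction n) auto
  then show ?thesis
    by (simp add: total_cost_def state_add)
qed

text \<open>Bellman's equation, the case of a single step.\<close>

lemma total_cost_Suc:
  "total_cost f l Vf (Suc n) x u =
    l (x, u 0) + total_cost f l Vf n (f (x, u 0)) (\<lambda>j. u (Suc j))"
  using total_cost_split[of f l Vf 1 n x u] by simp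

lemma total_cost_fun_upd:
  assumes "t < N"
  shows "total_cost f l Vf N x (u(t := v)) =
    (\<Sum>s<t. l (state f x u s, u s)) +
    (l (state f x u t, v) +
      total_cost f l Vf (N - Suc t) (f (state f x u t, v)) (\<lambda>j. u (Suc t + j)))"
proof -
  let ?u = "u(t := v)"
  have N: "N = t + Suc (N - Suc t)"
    using assms by simp
  have state: "state f x ?u s = state f x u s" if "s \<le> t" for s
    using that by (induction s) auto
  have "total_cost f l Vf N x ?u = (\<Sum>s<t. l (state f x ?u s, ?u s)) +
      total_cost f l Vf (Suc (N - Suc t)) (state f x ?u t) (\<lambda>j. ?u (t + j))"
    by (subst N, rule total_cost_split)
  then show ?thesis
    by (simp add: total_cost_Suc state)
qed

text \<open>Backward induction on \<open>s\<close>: the terminal condition is the case \<open>s = N\<close>, and each step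
  differentiates Bellman's equation.\<close>

lemma costate_is_gradient_of_cost_to_go:
  fixes a :: "int \<Rightarrow> real^'nx"
  assumes f: "f differentiable_on UNIV"
    and l: "l differentiable_on UNIV"
    and Vf: "Vf differentiable (at (state f x u N))"
    and terminal: "a (int N - 1) = gradient Vf (state f x u N)"
    and recursion: "\<And>t. t < N \<Longrightarrow> a (int t - 1) = l_x f l x u t + f_x f x u t (a (int t))"
    and "s \<le> N"
  shows "GDERIV (\<lambda>y. total_cost f l Vf (N - s) y (\<lambda>j. u (s + j))) (state f x u s) :> a (int s - 1)"
  using \<open>s \<le> N\<close>
proof (induction s rule: inc_induct)
  case base
  show ?case
    using gderiv_gradient[OF Vf] by (simp add: terminal total_cost_def)
next
  case (step s)
  let ?W = "\<lambda>y. total_cost f l Vf (N - Suc s) y (\<lambda>j. u (Suc s + j))"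
  have "N - s = Suc (N - Suc s)"
    using step.hyps by simp
  then have bellman: "(\<lambda>y. total_cost f l Vf (N - s) y (\<lambda>j. u (s + j))) =
      (\<lambda>y. l (y, u s) + ?W (f (y, u s)))"
    by (simp add: total_cost_Suc)
  have "GDERIV ?W (f (state f x u s, u s)) :> a (int s)"
    using step.IH by simp
  then show ?case
    unfolding bellman recursion[OF \<open>s < N\<close>] l_x_def f_x_def
    by (intro GDERIV_stage_plus_tail differentiable_partial f l)
qed

theorem proposition1:
  fixes f :: "(real^'nx) \<times> (real^'nu) \<Rightarrow> real^'nx"
    and l :: "(real^'nx) \<times> (real^'nu) \<Rightarrow> real"
    and Vf :: "real^'nx \<Rightarrow> real"
    and N :: nat
    and x :: "real^'nx"
    and u :: "nat \<Rightarrow> real^'nu"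
    and a :: "int \<Rightarrow> real^'nx"
  assumes "N \<ge> 1"
    and "f differentiable_on UNIV"
    and "l differentiable_on UNIV"
    and "Vf differentiable_on UNIV"
    and "a (int N - 1) = gradient Vf (state f x u N)"
    and "\<And>t. t < N \<Longrightarrow> a (int t - 1) = l_x f l x u t + f_x f x u t (a (int t))"
  shows "\<forall>t<N. (\<lambda>v. total_cost f l Vf N x (u(t := v))) differentiable (at (u t)) \<and>
    gradient (\<lambda>v. total_cost f l Vf N x (u(t := v))) (u t) = l_u f l x u t + f_u f x u t (a (int t))"
proof (intro allI impI)
  fix t assume t: "t < N"
  let ?W = "\<lambda>y. total_cost f l Vf (N - Suc t) y (\<lambda>j. u (Suc t + j))"
  have Vf: "Vf differentiable (at (state f x u N))"
    using assms(4) by (simp add: differentiable_on_def)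
  have "GDERIV ?W (f (state f x u t, u t)) :> a (int t)"
    using costate_is_gradient_of_cost_to_go[OF assms(2,3) Vf assms(5,6), of "Suc t"] t by simp
  then have "GDERIV (\<lambda>v. l (state f x u t, v) + ?W (f (state f x u t, v))) (u t) :>
      l_u f l x u t + f_u f x u t (a (int t))"
    unfolding l_u_def f_u_def
    by (intro GDERIV_stage_plus_tail differentiable_partial assms(2,3))
  from GDERIV_add[OF GDERIV_const this]
  have "GDERIV (\<lambda>v. total_cost f l Vf N x (u(t := v))) (u t) :>
      l_u f l x u t + f_u f x u t (a (int t))"
    unfolding total_cost_fun_upd[OF t] by simp
  then show "(\<lambda>v. total_cost f l Vf N x (u(t := v))) differentiable (at (u t)) \<and>
      gradient (\<lambda>v. total_cost f l Vf N x (u(t := v))) (u t) =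
        l_u f l x u t + f_u f x u t (a (int t))"
    by (intro conjI gradient_eqI)
qed

end
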